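(* Let $s$ and $t$ be positive integers and let $F$ be a gerechte framework of order $n$ in which every region is either an $s \times t$ rectangle or a $t \times s$ rectangle. Then $F$ is realizable.
   Context: A gerechte framework of order $n$ is a partition of the cells of an $n\times n$ array into $n$ regions, each containing $n$ cells. A latin square of order $n$ is an $n\times n$ array with symbols $1,\dots,n$ in which each symbol appears exactly once in each row and once in each column. A latin square realizes a gerechte framework (and is a realization of it) if, when its cells are partitioned by the framework, each region contains each symbol exactly once; a framework with a realization is called realizable. A region is an $a\times b$ rectangle if it consists of the cells lying in some $a$ consecutive rows and some $b$ consecutive columns (height $a$, width $b$). (Since each region has $n$ cells, necessarily $n=st$ here.) *)

theory Defs
  imports "HOL-Library.Disjoint_Sets"
begin

text \<open>A cell is a pair (row, column); rows, columns and symbols are numbered from 1.\<close>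

type_synonym cell = "nat \<times> nat"

definition cells :: "nat \<Rightarrow> cell set" where
  "cells n = {1..n} \<times> {1..n}"

definition gerechte_framework :: "nat \<Rightarrow> cell set set \<Rightarrow> bool" where
  "gerechte_framework n F \<longleftrightarrow>
     partition_on (cells n) F \<and> card F = n \<and> (\<forall>R\<in>F. card R = n)"

text \<open>The values of \<open>L\<close> outside \<open>cells n\<close> are irrelevant.\<close>

definition latin_square :: "nat \<Rightarrow> (cell \<Rightarrow> nat) \<Rightarrow> bool" where
  "latin_square n L \<longleftrightarrow>
     (\<forall>c\<in>cells n. L c \<in> {1..n}) \<and>
     (\<forall>i\<in>{1..n}. \<forall>k\<in>{1..n}. \<exists>!j\<in>{1..n}. L (i, j) = k) \<and>
     (\<forall>j\<in>{1..n}. \<forall>k\<in>{1..n}. \<exists>!i\<in>{1..n}. L (i, j) = k)"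

definition realizes :: "nat \<Rightarrow> (cell \<Rightarrow> nat) \<Rightarrow> cell set set \<Rightarrow> bool" where
  "realizes n L F \<longleftrightarrow>
     latin_square n L \<and> (\<forall>R\<in>F. \<forall>k\<in>{1..n}. \<exists>!c\<in>R. L c = k)"

definition realizable :: "nat \<Rightarrow> cell set set \<Rightarrow> bool" where
  "realizable n F \<longleftrightarrow> (\<exists>L. realizes n L F)"

text \<open>Height \<open>a\<close>, width \<open>b\<close>. The rectangle is not required here to lie inside
  an array; for regions of a framework this follows from the partition.\<close>

definition is_rectangle :: "nat \<Rightarrow> nat \<Rightarrow> cell set \<Rightarrow> bool" where
  "is_rectangle a b R \<longleftrightarrow> (\<exists>i j. R = {i..<i + a} \<times> {j..<j + b})"

end

theory Submission
  imports Defs "HOL-Number_Theory.Cong"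
begin

text \<open>Let \<open>d = gcd s t\<close>, \<open>s = d s'\<close>, \<open>t = d t'\<close>. Each row is cut by the regions into intervals of
  lengths \<open>s\<close> and \<open>t\<close>, so all corners lie on the \<open>d\<close>-grid. Symbols are tuples in
  \<open>[s'] \<times> [t'] \<times> [d] \<times> [d]\<close>. Consider an \<open>s \<times> t\<close> region with corner in block \<open>(P, Q)\<close> of the
  \<open>d\<close>-grid and a cell of it in block \<open>(I, J)\<close>. The cell gets first coordinate
  \<open>(Q + I) mod s'\<close> and second coordinate \<open>(P + J) mod t'\<close>; in a \<open>t \<times> s\<close> region the roles of rows and
  columns are swapped. The third coordinate depends only on the row of the cell and on its region:
  the regions meeting a block row split into \<open>d\<close> groups, each consisting of \<open>s'\<close> regions of the
  first kind with distinct \<open>Q mod s'\<close> or of \<open>t'\<close> regions of the second kind with distinct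
  \<open>Q mod t'\<close>, and the coordinate is the number of the group, shifted cyclically by the row. The
  fourth coordinate is obtained in the same way from the columns. In a row, the third coordinate
  then determines the group, the coordinate involving \<open>Q\<close> the region, and the other two
  the cell.\<close>

section \<open>Tilings of an interval\<close>

text \<open>Hypothesis \<open>c\<close> says that no interval straddles the cut \<open>c\<close>, so
  the intervals starting before it partition \<open>{..<c}\<close>.\<close>

lemma interval_tiling_sum:
  fixes q w :: "'r \<Rightarrow> nat"
  assumes "finite A"
    and cover: "\<And>x. x < n \<Longrightarrow> \<exists>!R. R \<in> A \<and> q R \<le> x \<and> x < q R + w R"
    and c: "c \<le> n" "\<And>R. R \<in> A \<Longrightarrow> q R < c \<Longrightarrow> q R + w R \<le> c"
  shows "c = (\<Sum>R | R \<in> A \<and> q R < c. w R)"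
proof -
  let ?B = "{R. R \<in> A \<and> q R < c}"
  have "{..<c} = (\<Union>R\<in>?B. {q R..<q R + w R})"
  proof (intro equalityI subsetI)
    fix x assume "x \<in> {..<c}"
    with c(1) cover[of x] obtain R where "R \<in> A" "q R \<le> x" "x < q R + w R" by auto
    with \<open>x \<in> {..<c}\<close> show "x \<in> (\<Union>R\<in>?B. {q R..<q R + w R})" by force
  next
    fix x assume "x \<in> (\<Union>R\<in>?B. {q R..<q R + w R})"
    with c(2) show "x \<in> {..<c}" by force
  qed
  moreover have "card (\<Union>R\<in>?B. {q R..<q R + w R}) = (\<Sum>R\<in>?B. card {q R..<q R + w R})"
  proof (rule card_UN_disjoint)
    show "\<forall>R\<in>?B. \<forall>R'\<in>?B. R \<noteq> R' \<longrightarrow> {q R..<q R + w R} \<inter> {q R'..<q R' + w R'} = {}"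
    proof (intro ballI impI, rule ccontr)
      fix R R' assume R: "R \<in> ?B" "R' \<in> ?B" "R \<noteq> R'"
        and "{q R..<q R + w R} \<inter> {q R'..<q R' + w R'} \<noteq> {}"
      then obtain x where x: "x \<in> {q R..<q R + w R}" "x \<in> {q R'..<q R' + w R'}" by blast
      with R c have "x < n" by force
      from cover[OF this] x R show False
        unfolding atLeastLessThan_iff mem_Collect_eq by blast
    qed
  qed (use \<open>finite A\<close> in auto)
  ultimately have "card {..<c} = (\<Sum>R\<in>?B. card {q R..<q R + w R})" by simp
  then show ?thesis by simp
qed

text \<open>Modulo \<open>s\<close> only the intervals of length \<open>d * t\<close> move the left endpoint, so consecutive ones
  have endpoints that run through all residues modulo \<open>s\<close>; hence they can be cut into groups of
  \<open>s\<close> consecutive ones. The groups of the two kinds are numbered from opposite ends of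
  \<open>{0..<d}\<close>.\<close>

lemma interval_tiling_groups:
  fixes q w :: "'r \<Rightarrow> nat" and s t d n :: nat
  assumes "finite A"
    and pos: "0 < s" "0 < t" "0 < d" and cop: "coprime s t" and n: "n = d * s * (d * t)"
    and cover: "\<And>x. x < n \<Longrightarrow> \<exists>!R. R \<in> A \<and> q R \<le> x \<and> x < q R + w R"
    and w: "\<And>R. R \<in> A \<Longrightarrow> w R = d * (if T R then t else s)"
    and bound: "\<And>R. R \<in> A \<Longrightarrow> q R + w R \<le> n"
  obtains h :: "'r \<Rightarrow> nat"
  where "\<And>R. R \<in> A \<Longrightarrow> d dvd q R" "\<And>R. R \<in> A \<Longrightarrow> h R < d"
    "\<And>R R'. R \<in> A \<Longrightarrow> R' \<in> A \<Longrightarrow> h R = h R' \<Longrightarrow> T R = T R'"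
    "\<And>R R'. R \<in> A \<Longrightarrow> R' \<in> A \<Longrightarrow> h R = h R' \<Longrightarrow>
      [q R div d = q R' div d] (mod (if T R then s else t)) \<Longrightarrow> R = R'"
proof -
  \<comment> \<open>Here \<open>s\<close> and \<open>t\<close> are the coprime factors
    \<open>s'\<close> and \<open>t'\<close> of the overview. \<open>k (T R) (q R)\<close> is the
    rank of \<open>R\<close>, from the left, among the intervals of its kind.\<close>
  define k where "k b c = card {R \<in> A. T R = b \<and> q R < c}" for b c
  have wpos: "0 < w R" if "R \<in> A" for R using w[OF that] pos by simp
  have eqI: "R = R'" if "R \<in> A" "R' \<in> A" "q R = q R'" for R R'
  proof -
    from bound wpos that have "q R < n" by (metis add_less_cancel_left add_0_right order_less_le_trans)
    from cover[OF this] that wpos[of R] wpos[of R'] show ?thesis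
      by (metis add_0_right add_less_cancel_left order_refl)
  qed
  have kmono: "k (T R) (q R) < k (T R) c" if "R \<in> A" "q R < c" for R c
    unfolding k_def
    by (rule psubset_card_mono) (use \<open>finite A\<close> that in auto)
  have kinj: "R = R'" if "R \<in> A" "R' \<in> A" "T R = T R'" "k (T R) (q R) = k (T R) (q R')" for R R'
  proof (rule eqI)
    show "q R = q R'"
      using kmono[of R "q R'"] kmono[of R' "q R"] that
      by (cases "q R" "q R'" rule: linorder_cases) auto
  qed (use that in auto)
  have sum: "c = d * (t * k True c + s * k False c)"
    if "c \<le> n" "\<And>R. R \<in> A \<Longrightarrow> q R < c \<Longrightarrow> q R + w R \<le> c" for c
  proof -
    have "c = (\<Sum>R | R \<in> A \<and> q R < c. w R)"
      by (rule interval_tiling_sum[where n = n]) (use assms that in auto)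
    also have "{R. R \<in> A \<and> q R < c} = {R \<in> A. T R = True \<and> q R < c} \<union> {R \<in> A. T R = False \<and> q R < c}"
      by auto
    also have "(\<Sum>R\<in>\<dots>. w R) = (\<Sum>R\<in>{R \<in> A. T R = True \<and> q R < c}. w R) + (\<Sum>R\<in>{R \<in> A. T R = False \<and> q R < c}. w R)"
      by (rule sum.union_disjoint) (use \<open>finite A\<close> in auto)
    also have "\<dots> = (\<Sum>R\<in>{R \<in> A. T R = True \<and> q R < c}. d * t) + (\<Sum>R\<in>{R \<in> A. T R = False \<and> q R < c}. d * s)"
      by (intro arg_cong2[of _ _ _ _ "(+)"] sum.cong) (auto simp: w)
    finally show ?thesis by (simp add: k_def algebra_simps)
  qed
  \<comment> \<open>An interval straddling \<open>q R\<close> would cover that point together with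
    \<open>R\<close>, so \<open>q R\<close> is an admissible cut.\<close>
  have qsum: "q R = d * (t * k True (q R) + s * k False (q R))" if R: "R \<in> A" for R
  proof (rule sum)
    show "q R \<le> n" using bound[OF R] by simp
    fix R' assume R': "R' \<in> A" "q R' < q R"
    show "q R' + w R' \<le> q R"
    proof (rule ccontr)
      assume "\<not> ?thesis"
      moreover have "q R < n" using bound[OF R] wpos[OF R] by simp
      ultimately have "R = R'"
        using cover[of "q R"] R R' wpos[OF R] by (metis add.right_neutral add_less_cancel_left less_or_eq_imp_le not_le)
      with R' show False by simp
    qed
  qed
  have "n = d * (t * k True n + s * k False n)"
    by (rule sum) (use bound in auto)
  with n pos have total: "d * s * t = t * k True n + s * k False n"
    by (simp add: mult.assoc)
  \<comment> \<open>Coprimality makes the number of intervals of each kind a multiple of its group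
    size. The quotients \<open>a\<close> and \<open>b\<close> count the groups, hence
    \<open>d = a + b\<close>.\<close>
  have "s dvd t * k True n"
    using total by (metis dvd_add_left_iff dvd_triv_left dvd_mult2 dvd_mult mult.commute)
  with cop obtain a where a: "k True n = s * a"
    by (auto simp: coprime_dvd_mult_right_iff elim: dvdE)
  have "t dvd s * k False n"
    using total by (metis dvd_add_right_iff dvd_triv_left dvd_triv_right)
  with cop obtain b where b: "k False n = t * b"
    by (auto simp: coprime_dvd_mult_right_iff coprime_commute elim: dvdE)
  have "s * t * d = s * t * (a + b)" using total a b by (simp add: algebra_simps)
  then have d: "d = a + b" using pos by simp
  \<comment> \<open>Intervals with \<open>T\<close> get values below \<open>a\<close>, the others
    values from \<open>a\<close> to \<open>d - 1\<close>, so the value reveals the kind.\<close>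
  define h where "h R = (if T R then k True (q R) div s else d - 1 - k False (q R) div t)" for R
  have hT: "k True (q R) div s < a" if "R \<in> A" "T R" for R
    using kmono[of R n] bound[OF that(1)] wpos[OF that(1)] a that pos
    by (simp add: less_mult_imp_div_less mult.commute)
  have hF: "k False (q R) div t < b" if "R \<in> A" "\<not> T R" for R
    using kmono[of R n] bound[OF that(1)] wpos[OF that(1)] b that pos
    by (simp add: less_mult_imp_div_less mult.commute)
  have div_eq: "q R div d = t * k True (q R) + s * k False (q R)" if "R \<in> A" for R
    using qsum[OF that] pos by (metis nonzero_mult_div_cancel_left less_irrefl)
  show ?thesis
  proof
    fix R assume R: "R \<in> A"
    show "d dvd q R" using qsum[OF R] by (metis dvd_triv_left)
    show "h R < d" using hT[OF R] d pos by (auto simp: h_def)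
  next
    fix R R' assume R: "R \<in> A" "R' \<in> A" and h: "h R = h R'"
    show T: "T R = T R'"
      using h hT[OF R(1)] hF[OF R(1)] hT[OF R(2)] hF[OF R(2)] d
      by (auto simp: h_def split: if_splits)
    assume cong: "[q R div d = q R' div d] (mod (if T R then s else t))"
    show "R = R'"
    proof (cases "T R")
      case True
      \<comment> \<open>Modulo \<open>s\<close> one summand vanishes and \<open>t\<close> cancels,
        so the endpoint gives the rank modulo \<open>s\<close>. Since \<open>h\<close> gives the
        rank divided by \<open>s\<close>, the ranks agree and \<open>kinj\<close> applies.\<close>
      with cong have "[t * k True (q R) + s * k False (q R) = t * k True (q R') + s * k False (q R')] (mod s)"
        by (simp add: div_eq R)
      then have "[t * k True (q R) = t * k True (q R')] (mod s)"
        by (simp add: cong_def)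
      then have "k True (q R) mod s = k True (q R') mod s"
        using cop by (simp add: cong_mult_lcancel_nat coprime_commute cong_def[symmetric])
      moreover have "k True (q R) div s = k True (q R') div s"
        using h True T by (simp add: h_def)
      ultimately show ?thesis using kinj[of R R'] R T True by (metis div_mod_decomp)
    next
      case False
      with cong have "[t * k True (q R) + s * k False (q R) = t * k True (q R') + s * k False (q R')] (mod t)"
        by (simp add: div_eq R)
      then have "[s * k False (q R) = s * k False (q R')] (mod t)"
        by (simp add: cong_def)
      then have "k False (q R) mod t = k False (q R') mod t"
        using cop by (simp add: cong_mult_lcancel_nat cong_def[symmetric])
      moreover have "k False (q R) div t = k False (q R') div t"
        using h False T hF[of R] hF[of R'] R d by (simp add: h_def)
      ultimately show ?thesis using kinj[of R R'] R T False by (metis div_mod_decomp)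
    qed
  qed
qed

text \<open>A common shift cancels modulo \<open>m\<close>, and a window of length \<open>m\<close>
  contains each residue only once. This decodes the symbol coordinates.\<close>

lemma mod_interval_inj:
  fixes a b c e m :: nat
  assumes "(e + a) mod m = (e + b) mod m" "c \<le> a" "a < c + m" "c \<le> b" "b < c + m"
  shows "a = b"
proof -
  from assms obtain a' b' where ab: "a = c + a'" "b = c + b'"
    by (metis le_Suc_ex)
  with assms(1) have "[e + c + a' = e + c + b'] (mod m)" by (simp add: cong_def add.assoc)
  then have "[a' = b'] (mod m)" by (simp only: cong_add_lcancel_nat)
  with assms ab have "a' = b'" by (intro cong_less_modulus_unique_nat[of a' b' m]) auto
  with ab show ?thesis by simp
qed

section \<open>Tilings of a square by rectangles in two orientations\<close>

text \<open>Corners are counted from 0, and \<open>s\<close> and \<open>t\<close> are the side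
  lengths already divided by their gcd \<open>d\<close>.\<close>

locale rectangle_tiling =
  fixes A :: "'r set" and p q :: "'r \<Rightarrow> nat" and T :: "'r \<Rightarrow> bool" and d s t n :: nat
  assumes fin: "finite A"
    and pos: "0 < s" "0 < t" "0 < d" and cop: "coprime s t" and n: "n = d * s * (d * t)"
    and height: "\<And>R. R \<in> A \<Longrightarrow> p R + d * (if T R then s else t) \<le> n"
    and width: "\<And>R. R \<in> A \<Longrightarrow> q R + d * (if T R then t else s) \<le> n"
    and cover: "\<And>i j. i < n \<Longrightarrow> j < n \<Longrightarrow> \<exists>!R. R \<in> A \<and>
      (p R \<le> i \<and> i < p R + d * (if T R then s else t)) \<and>
      (q R \<le> j \<and> j < q R + d * (if T R then t else s))"
begin

text \<open>Exchanging rows and columns swaps the orientations, so \<open>T\<close> is negated while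
  \<open>s\<close> and \<open>t\<close> stay. Facts about rows thus yield their column
  versions.\<close>

lemma transpose: "rectangle_tiling A q p (\<lambda>R. \<not> T R) d s t n"
proof
  have swap: "(if \<not> b then x else y) = (if b then y else x)" for b and x y :: nat by simp
  fix i j assume "i < n" "j < n"
  from cover[OF this(2,1)] show "\<exists>!R. R \<in> A \<and>
      (q R \<le> i \<and> i < q R + d * (if \<not> T R then s else t)) \<and>
      (p R \<le> j \<and> j < p R + d * (if \<not> T R then t else s))"
    by (simp only: swap conj_ac)
next
  fix R assume "R \<in> A"
  then show "q R + d * (if \<not> T R then s else t) \<le> n" "p R + d * (if \<not> T R then t else s) \<le> n"
    using height[of R] width[of R] by (auto split: if_splits)
qed (use fin pos cop n in auto)

definition meets_row :: "'r \<Rightarrow> nat \<Rightarrow> bool" where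
  "meets_row R i \<longleftrightarrow> R \<in> A \<and> p R \<le> i \<and> i < p R + d * (if T R then s else t)"

definition covers :: "'r \<Rightarrow> nat \<Rightarrow> nat \<Rightarrow> bool" where
  "covers R i j \<longleftrightarrow> meets_row R i \<and> q R \<le> j \<and> j < q R + d * (if T R then t else s)"

definition row_grouping :: "(nat \<Rightarrow> 'r \<Rightarrow> nat) \<Rightarrow> bool" where
  "row_grouping h \<longleftrightarrow> (\<forall>i R R'. meets_row R i \<longrightarrow> meets_row R' i \<longrightarrow>
     h i R < d \<and> (h i R = h i R' \<longrightarrow> T R = T R' \<and>
       ([q R div d = q R' div d] (mod (if T R then s else t)) \<longrightarrow> R = R')))"

text \<open>The regions meeting a row cut it into intervals, to which
  \<open>interval_tiling_groups\<close> applies.\<close>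

lemma row_grouping_at:
  assumes "i < n"
  obtains h :: "'r \<Rightarrow> nat"
  where "\<And>R. meets_row R i \<Longrightarrow> d dvd q R" "\<And>R. meets_row R i \<Longrightarrow> h R < d"
    "\<And>R R'. meets_row R i \<Longrightarrow> meets_row R' i \<Longrightarrow> h R = h R' \<Longrightarrow> T R = T R'"
    "\<And>R R'. meets_row R i \<Longrightarrow> meets_row R' i \<Longrightarrow> h R = h R' \<Longrightarrow>
      [q R div d = q R' div d] (mod (if T R then s else t)) \<Longrightarrow> R = R'"
proof -
  let ?A = "{R. meets_row R i}"
  have A: "finite ?A"
    by (rule finite_subset[OF _ fin]) (auto simp: meets_row_def)
  have cover_i: "\<exists>!R. R \<in> ?A \<and> q R \<le> x \<and> x < q R + d * (if T R then t else s)" if "x < n" for x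
    using cover[OF assms that] by (simp add: meets_row_def conj_assoc)
  have width_i: "q R + d * (if T R then t else s) \<le> n" if "R \<in> ?A" for R
    using width that by (simp add: meets_row_def)
  show ?thesis
  proof (rule interval_tiling_groups[OF A pos cop n cover_i refl width_i])
    fix h
    assume "\<And>R. R \<in> ?A \<Longrightarrow> d dvd q R" "\<And>R. R \<in> ?A \<Longrightarrow> h R < d"
      "\<And>R R'. R \<in> ?A \<Longrightarrow> R' \<in> ?A \<Longrightarrow> h R = h R' \<Longrightarrow> T R = T R'"
      "\<And>R R'. R \<in> ?A \<Longrightarrow> R' \<in> ?A \<Longrightarrow> h R = h R' \<Longrightarrow>
        [q R div d = q R' div d] (mod (if T R then s else t)) \<Longrightarrow> R = R'"
    then show thesis by (intro that[of h]; unfold mem_Collect_eq) blast+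
  qed
qed

lemma meets_row_less: "meets_row R i \<Longrightarrow> i < n"
  using height[of R] by (auto simp: meets_row_def)

lemma ex_row_grouping: "\<exists>h. row_grouping h"
proof -
  have "\<exists>h. \<forall>R R'. meets_row R i \<longrightarrow> meets_row R' i \<longrightarrow>
     h R < d \<and> (h R = h R' \<longrightarrow> T R = T R' \<and>
       ([q R div d = q R' div d] (mod (if T R then s else t)) \<longrightarrow> R = R'))" for i
  proof (cases "i < n")
    case True
    show ?thesis by (rule row_grouping_at[OF True]) blast
  next
    case False
    then show ?thesis using meets_row_less by blast
  qed
  then show ?thesis unfolding row_grouping_def by metis
qed

lemma dvd_left: "R \<in> A \<Longrightarrow> d dvd q R"
proof -
  assume R: "R \<in> A"
  with pos have m: "meets_row R (p R)" by (simp add: meets_row_def)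
  show ?thesis by (rule row_grouping_at[OF meets_row_less[OF m]]) (use m in blast)
qed

lemma dvd_top: "R \<in> A \<Longrightarrow> d dvd p R"
  using rectangle_tiling.dvd_left[OF transpose] .

lemma block_interval:
  assumes "d dvd e" "e \<le> i" "i < e + d * m"
  shows "e div d \<le> i div d" "i div d < e div d + m"
proof -
  show "e div d \<le> i div d" using assms(2) by (rule div_le_mono)
  from assms(1) obtain k where "e = d * k" ..
  with assms(3) have "i < (k + m) * d" by (simp add: algebra_simps)
  with \<open>e = d * k\<close> pos(3) show "i div d < e div d + m"
    by (simp add: less_mult_imp_div_less)
qed

text \<open>Top edges and heights are multiples of \<open>d\<close>, so a region meets all rows of a
  block row or none.\<close>

lemma meets_row_block:
  assumes "meets_row R i"
  shows "meets_row R (d * (i div d))"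
proof -
  from assms obtain k where k: "p R = d * k"
    using dvd_top by (auto simp: meets_row_def)
  have "k \<le> i div d" "i div d < k + (if T R then s else t)"
    using block_interval[of "p R" i "if T R then s else t"] assms k pos by (auto simp: meets_row_def)
  then have "d * k \<le> d * (i div d)" "d * (i div d) < d * (k + (if T R then s else t))"
    using pos by auto
  with assms k show ?thesis by (simp add: meets_row_def distrib_left)
qed

section \<open>Construction of the symbols\<close>

text \<open>Inside a region the block index used here runs through \<open>s\<close> consecutive
  values, so the residue determines it. Along a line where that index is constant, the residue
  reveals the corner instead.\<close>

definition symX :: "'r \<Rightarrow> nat \<Rightarrow> nat \<Rightarrow> nat" where
  "symX R i j = (if T R then q R div d + i div d else p R div d + j div d) mod s"

definition symY :: "'r \<Rightarrow> nat \<Rightarrow> nat \<Rightarrow> nat" where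
  "symY R i j = (if T R then p R div d + j div d else q R div d + i div d) mod t"

text \<open>The grouping is taken at the first row of the block row, so all its \<open>d\<close>
  rows share it; the shift \<open>i mod d\<close> tells these rows apart inside a region.\<close>

definition twist :: "(nat \<Rightarrow> 'r \<Rightarrow> nat) \<Rightarrow> 'r \<Rightarrow> nat \<Rightarrow> nat" where
  "twist h R i = (h (d * (i div d)) R + i mod d) mod d"

lemma twist_inj:
  assumes "twist h R i = twist h R i'" "i div d = i' div d"
  shows "i = i'"
proof -
  have "i mod d = i' mod d"
    by (rule mod_interval_inj[of "h (d * (i div d)) R" _ d _ 0]) (use assms pos in \<open>auto simp: twist_def\<close>)
  with assms(2) show ?thesis by (metis div_mod_decomp)
qed

text \<open>With the corner fixed, \<open>symX\<close> and \<open>symY\<close> determine the block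
  of the cell, and the two twists its position in the block.\<close>

lemma region_inj:
  assumes R: "covers R i j" "covers R i' j'"
    and "symX R i j = symX R i' j'" "symY R i j = symY R i' j'"
    and "twist h R i = twist h R i'" "twist g R j = twist g R j'"
  shows "i = i' \<and> j = j'"
proof -
  let ?I = "\<lambda>i. p R div d \<le> i div d \<and> i div d < p R div d + (if T R then s else t)"
  let ?J = "\<lambda>j. q R div d \<le> j div d \<and> j div d < q R div d + (if T R then t else s)"
  have "?I i" "?I i'" "?J j" "?J j'"
    using R block_interval dvd_top[of R] dvd_left[of R] by (auto simp: covers_def meets_row_def)
  with assms(3,4) have "i div d = i' div d" "j div d = j' div d"
    by (auto simp: symX_def symY_def split: if_splits dest: mod_interval_inj)
  with assms(5,6) show ?thesis using twist_inj by blast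
qed

lemma row_inj:
  assumes h: "row_grouping h" and R: "covers R i j" "covers R' i j'"
    and sym: "symX R i j = symX R' i j'" "symY R i j = symY R' i j'"
    and tw: "twist h R i = twist h R' i" "twist g R j = twist g R' j'"
  shows "j = j'"
proof -
  let ?i = "d * (i div d)"
  from R have m: "meets_row R ?i" "meets_row R' ?i"
    using meets_row_block[of R i] meets_row_block[of R' i] by (simp_all add: covers_def)
  with h have less: "h ?i R < d" "h ?i R' < d" unfolding row_grouping_def by blast+
  have h_eq: "h ?i R = h ?i R'"
    by (rule mod_interval_inj[of "i mod d" _ d _ 0]) (use tw less in \<open>auto simp: twist_def add.commute\<close>)
  with h m have T: "T R = T R'" unfolding row_grouping_def by blast
  \<comment> \<open>For either kind, one of \<open>symX\<close> and \<open>symY\<close> pairs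
    \<open>q\<close> with the row index, which both cells share.\<close>
  with sym have "[q R div d + i div d = q R' div d + i div d] (mod (if T R then s else t))"
    by (auto simp: symX_def symY_def cong_def)
  then have "[q R div d = q R' div d] (mod (if T R then s else t))"
    by (simp only: cong_add_rcancel_nat)
  with h m h_eq have "R = R'" unfolding row_grouping_def by blast
  with region_inj[of R i j i j'] assms show ?thesis by blast
qed

lemma ex_cover: "i < n \<Longrightarrow> j < n \<Longrightarrow> \<exists>R. covers R i j"
  using ex1_implies_ex[OF cover[of i j]] unfolding covers_def meets_row_def by blast

lemma ex_symbols:
  obtains L :: "nat \<Rightarrow> nat \<Rightarrow> nat \<times> nat \<times> nat \<times> nat"
  where "\<And>i j. L i j \<in> {..<s} \<times> {..<t} \<times> {..<d} \<times> {..<d}"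
    "\<And>i j j'. \<lbrakk>i < n; j < n; j' < n; L i j = L i j'\<rbrakk> \<Longrightarrow> j = j'"
    "\<And>i i' j. \<lbrakk>i < n; i' < n; j < n; L i j = L i' j\<rbrakk> \<Longrightarrow> i = i'"
    "\<And>R i j i' j'. \<lbrakk>covers R i j; covers R i' j'; L i j = L i' j'\<rbrakk> \<Longrightarrow> i = i' \<and> j = j'"
proof -
  interpret tr: rectangle_tiling A q p "\<lambda>R. \<not> T R" d s t n by (rule transpose)
  obtain h g where h: "row_grouping h" and g: "tr.row_grouping g"
    using ex_row_grouping tr.ex_row_grouping by blast
  define reg where "reg i j = (SOME R. covers R i j)" for i j
  have reg: "covers (reg i j) i j" if "i < n" "j < n" for i j
    using someI_ex[OF ex_cover[OF that]] by (simp add: reg_def)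
  have reg_eq: "reg i j = R" if "covers R i j" for R i j
  proof -
    have *: "i < n" "j < n"
      using that height[of R] width[of R] by (auto simp: covers_def meets_row_def)
    from cover[OF *] reg[OF *] that show ?thesis unfolding covers_def meets_row_def by blast
  qed
  \<comment> \<open>The first two coordinates are invariant under transposition, so
    \<open>tr.row_inj\<close> yields injectivity in columns, with \<open>h\<close> and
    \<open>g\<close> exchanged.\<close>
  have tr: "tr.covers R j i = covers R i j" "tr.symX R j i = symX R i j"
    "tr.symY R j i = symY R i j" for R i j
    by (auto simp: covers_def meets_row_def tr.covers_def tr.meets_row_def symX_def tr.symX_def
        symY_def tr.symY_def)
  define L where "L i j = (symX (reg i j) i j, symY (reg i j) i j,
    twist h (reg i j) i, twist g (reg i j) j)" for i j
  show ?thesis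
  proof
    show "L i j \<in> {..<s} \<times> {..<t} \<times> {..<d} \<times> {..<d}" for i j
      using pos by (simp add: L_def symX_def symY_def twist_def)
    show "j = j'" if "i < n" "j < n" "j' < n" "L i j = L i j'" for i j j'
      using row_inj[OF h reg reg, of i j j' g] that by (simp add: L_def)
    show "i = i'" if "i < n" "i' < n" "j < n" "L i j = L i' j" for i i' j
      using tr.row_inj[OF g, of "reg i j" j i "reg i' j" i' h] reg that by (simp add: L_def tr)
    show "i = i' \<and> j = j'" if "covers R i j" "covers R i' j'" "L i j = L i' j'" for R i j i' j'
      using region_inj[of R i j i' j' h g] that reg_eq[OF that(1)] reg_eq[OF that(2)] by (simp add: L_def)
  qed
qed

end

section \<open>From the tiling to a realization of the framework\<close>

lemma inj_on_card_ex1: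
  assumes "inj_on f A" "f ` A \<subseteq> B" "finite B" "card A = card B" "k \<in> B"
  shows "\<exists>!x. x \<in> A \<and> f x = k"
proof -
  have "f ` A = B"
    using card_subset_eq[OF assms(3,2)] card_image[OF assms(1)] assms(4) by simp
  with assms(5) obtain x where "x \<in> A" "f x = k" by blast
  then show ?thesis using inj_onD[OF assms(1)] by blast
qed

theorem theorem1:
  fixes s t n :: nat and F :: "cell set set"
  assumes "0 < s" and "0 < t"
    and "gerechte_framework n F"
    and "\<forall>R\<in>F. is_rectangle s t R \<or> is_rectangle t s R"
  shows "realizable n F"
\<comment> \<open>A framework of order 0 has no region from which to read off
  \<open>n = s * t\<close>, so this case is separate.\<close>
proof (cases "n = 0")
  case True
  with assms(3) have "F = {}"
    by (auto simp: gerechte_framework_def cells_def partition_on_def)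
  with True show ?thesis by (simp add: realizable_def realizes_def latin_square_def cells_def)
next
  case False
  define d where "d = gcd s t"
  define s' t' where "s' = s div d" and "t' = t div d"
  have pos: "0 < d" "0 < s'" "0 < t'" and cop: "coprime s' t'" and st: "s = d * s'" "t = d * t'"
    using assms(1,2) by (auto simp: d_def s'_def t'_def div_gcd_coprime div_greater_zero_iff gcd_le1_nat gcd_le2_nat)
  from assms(3) have part: "partition_on (cells n) F" and card_R: "\<And>R. R \<in> F \<Longrightarrow> card R = n"
    and "card F = n" by (auto simp: gerechte_framework_def)
  with False have "finite F" "F \<noteq> {}" by (auto simp: card_gt_0_iff intro: card_ge_0_finite)
  \<comment> \<open>\<open>b\<close> records the orientation; if \<open>s = t\<close>, either value
    serves.\<close>
  have "\<exists>P Q b. R = {P..<P + (if b then s else t)} \<times> {Q..<Q + (if b then t else s)}" if "R \<in> F" for R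
  proof -
    from assms(4) that obtain P Q where
      "R = {P..<P + s} \<times> {Q..<Q + t} \<or> R = {P..<P + t} \<times> {Q..<Q + s}"
      unfolding is_rectangle_def by blast
    then show ?thesis
      by (metis (full_types))
  qed
  then obtain P Q b where R_eq: "\<And>R. R \<in> F \<Longrightarrow>
      R = {P R..<P R + (if b R then s else t)} \<times> {Q R..<Q R + (if b R then t else s)}"
    by metis
  from \<open>F \<noteq> {}\<close> obtain R0 where "R0 \<in> F" by blast
  have "card R0 = s * t"
    by (subst R_eq[OF \<open>R0 \<in> F\<close>]) (simp add: card_cartesian_product mult.commute)
  with card_R[OF \<open>R0 \<in> F\<close>] have n: "n = s * t" by simp
  \<comment> \<open>Conversion to corners counted from 0. As regions lie in the array,
    \<open>P R\<close> and \<open>Q R\<close> are at least 1 and the subtraction does not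
    truncate.\<close>
  define p q where "p R = P R - 1" and "q R = Q R - 1" for R
  have bounds: "P R = p R + 1" "Q R = q R + 1" "p R + d * (if b R then s' else t') \<le> n"
    "q R + d * (if b R then t' else s') \<le> n" if "R \<in> F" for R
  proof -
    let ?a = "if b R then s else t" and ?b = "if b R then t else s"
    have sub: "R \<subseteq> {1..n} \<times> {1..n}"
      using part that by (auto simp: partition_on_def cells_def)
    have "(x, y) \<in> R \<longleftrightarrow> P R \<le> x \<and> x < P R + ?a \<and> Q R \<le> y \<and> y < Q R + ?b" for x y
      by (subst R_eq[OF that]) auto
    then have "(P R, Q R) \<in> R" "(P R + ?a - 1, Q R + ?b - 1) \<in> R"
      using assms(1,2) by (auto split: if_splits)
    with sub have "1 \<le> P R" "1 \<le> Q R" "P R + ?a - 1 \<le> n" "Q R + ?b - 1 \<le> n"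
      by auto
    then show "P R = p R + 1" "Q R = q R + 1" "p R + d * (if b R then s' else t') \<le> n"
      "q R + d * (if b R then t' else s') \<le> n"
      using st by (auto simp: p_def q_def split: if_splits)
  qed
  have mem: "(Suc i, Suc j) \<in> R \<longleftrightarrow> (p R \<le> i \<and> i < p R + d * (if b R then s' else t')) \<and>
      (q R \<le> j \<and> j < q R + d * (if b R then t' else s'))" if "R \<in> F" for R i j
    by (subst R_eq[OF that]) (use bounds[OF that] st in auto)
  interpret rectangle_tiling F p q b d s' t' n
  proof
    fix i j assume "i < n" "j < n"
    then have "(Suc i, Suc j) \<in> cells n" by (simp add: cells_def)
    with part have "\<exists>!R. R \<in> F \<and> (Suc i, Suc j) \<in> R"
      by (auto simp: partition_on_def disjoint_def)
    then show "\<exists>!R. R \<in> F \<and>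
      (p R \<le> i \<and> i < p R + d * (if b R then s' else t')) \<and>
      (q R \<le> j \<and> j < q R + d * (if b R then t' else s'))"
      by (simp add: mem cong: conj_cong)
  qed (use \<open>finite F\<close> pos cop n st bounds(3,4) in simp_all)
  obtain L where L: "\<And>i j. L i j \<in> {..<s'} \<times> {..<t'} \<times> {..<d} \<times> {..<d}"
    "\<And>i j j'. \<lbrakk>i < n; j < n; j' < n; L i j = L i j'\<rbrakk> \<Longrightarrow> j = j'"
    "\<And>i i' j. \<lbrakk>i < n; i' < n; j < n; L i j = L i' j\<rbrakk> \<Longrightarrow> i = i'"
    "\<And>R i j i' j'. \<lbrakk>covers R i j; covers R i' j'; L i j = L i' j'\<rbrakk> \<Longrightarrow> i = i' \<and> j = j'"
    by (rule ex_symbols) blast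
  have "card ({..<s'} \<times> {..<t'} \<times> {..<d} \<times> {..<d}) = card {1..n}"
    using n st by (simp add: card_cartesian_product)
  \<comment> \<open>Any bijection serves, since renaming symbols preserves injectivity on rows,
    columns and regions.\<close>
  then obtain \<phi> where \<phi>: "bij_betw \<phi> ({..<s'} \<times> {..<t'} \<times> {..<d} \<times> {..<d}) {1..n}"
    using finite_same_card_bij[of "{..<s'} \<times> {..<t'} \<times> {..<d} \<times> {..<d}" "{1..n}"] by auto
  have \<phi>_eq: "\<phi> (L i j) = \<phi> (L i' j') \<Longrightarrow> L i j = L i' j'" for i j i' j'
    using \<phi> L(1) by (meson bij_betw_imp_inj_on inj_onD)
  define M where "M = (\<lambda>(i, j). \<phi> (L (i - 1) (j - 1)))"
  have M: "M c \<in> {1..n}" for c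
    using \<phi> L(1) by (auto simp: M_def bij_betw_def split: prod.splits)
  have row: "\<exists>!j. j \<in> {1..n} \<and> M (i, j) = k" if ik: "i \<in> {1..n}" "k \<in> {1..n}" for i k
  proof (rule inj_on_card_ex1[OF _ _ _ refl ik(2)])
    show "inj_on (\<lambda>j. M (i, j)) {1..n}"
    proof (rule inj_onI)
      fix j j' assume j: "j \<in> {1..n}" "j' \<in> {1..n}" and "M (i, j) = M (i, j')"
      then have "L (i - 1) (j - 1) = L (i - 1) (j' - 1)" by (intro \<phi>_eq) (simp add: M_def)
      with L(2)[of "i - 1" "j - 1" "j' - 1"] j ik(1) have "j - 1 = j' - 1" by auto
      with j show "j = j'" by auto
    qed
  qed (use M in blast)+
  have col: "\<exists>!i. i \<in> {1..n} \<and> M (i, j) = k" if jk: "j \<in> {1..n}" "k \<in> {1..n}" for j k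
  proof (rule inj_on_card_ex1[OF _ _ _ refl jk(2)])
    show "inj_on (\<lambda>i. M (i, j)) {1..n}"
    proof (rule inj_onI)
      fix i i' assume i: "i \<in> {1..n}" "i' \<in> {1..n}" and "M (i, j) = M (i', j)"
      then have "L (i - 1) (j - 1) = L (i' - 1) (j - 1)" by (intro \<phi>_eq) (simp add: M_def)
      with L(3)[of "i - 1" "i' - 1" "j - 1"] i jk(1) have "i - 1 = i' - 1" by auto
      with i show "i = i'" by auto
    qed
  qed (use M in blast)+
  have reg: "\<exists>!c. c \<in> R \<and> M c = k" if R: "R \<in> F" and k: "k \<in> {1..n}" for R k
  proof (rule inj_on_card_ex1[OF _ _ _ _ k])
    show "inj_on M R"
    proof (rule inj_onI)
      fix c c' assume c: "c \<in> R" "c' \<in> R" and M_eq: "M c = M c'"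
      have "\<exists>i j. x = (Suc i, Suc j)" if "x \<in> R" for x
      proof -
        have "x \<in> cells n" using part R that by (auto simp: partition_on_def)
        then have "0 < fst x" "0 < snd x" by (auto simp: cells_def)
        then show ?thesis by (metis gr0_conv_Suc prod.collapse)
      qed
      with c obtain i j i' j' where ij: "c = (Suc i, Suc j)" "c' = (Suc i', Suc j')"
        by blast
      with c R mem[OF R] have "covers R i j" "covers R i' j'"
        by (auto simp: covers_def meets_row_def)
      moreover have "L i j = L i' j'"
        by (rule \<phi>_eq) (use M_eq ij in \<open>simp add: M_def\<close>)
      ultimately show "c = c'" using L(4) ij by blast
    qed
    show "card R = card {1..n}" using card_R[OF R] by simp
  qed (use M in blast)+
  have "realizes n M F"
    unfolding realizes_def latin_square_def by (intro conjI ballI M row col reg)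
  then show ?thesis unfolding realizable_def by blast
qed

end
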